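(* For any $\gamma\in(0,\infty)$, the function $\beta\mapsto\lambda_*(\gamma,\beta)$ is increasing on $(0,\infty)$, and $$\lim_{\beta\to\infty}\lambda_*(\gamma,\beta)=1+\sqrt\gamma.$$
   Context: $\phi(z)=(2\pi)^{-1/2}e^{-z^2/2}$, $\langle f,g\rangle_\phi=\int fg\,\phi$, $\|f\|_\phi^2=\langle f,f\rangle_\phi$; $L^2_o(\phi)$ is the set of odd functions $f:\mathbb R\to\mathbb R$ with $\|f\|_\phi<\infty$; $\{h_k\}$ are the Hermite polynomials normalized so that $\langle h_k,h_\ell\rangle_\phi=\mathbf 1_{k=\ell}$ (positive leading coefficient). For $f\in L_o^2(\phi)$ with $a_k:=\langle f,h_k\rangle_\phi$, $\tau(f,\beta,\lambda):=\sum_{\ell\ge3}\frac{a_\ell(\lambda-1)^\ell}{\sqrt{\ell!}\,\beta^{\ell-1}}$. Recovery region. For $\gamma,\beta\in(0,\infty)$, $\mathcal R(f,\gamma,\beta,\cdot)$ is the set of $\lambda>1$ such that, with $\tau=\tau(f,\beta,\lambda)$: either $a_1>0$ and $\psi'(s_+)>0$, where $$\psi'(s)=\frac1{s^2}-\frac{a_1^2\gamma}{(1+a_1\gamma s)^2}-\gamma(\|f\|_\phi^2-a_1^2),\qquad s_+=\frac{-a_1(\lambda+\gamma-1)-\tau+\sqrt{(a_1(\lambda+\gamma-1)+\tau)^2-4a_1\gamma\tau}}{2a_1\gamma\tau}$$ (with $s_+=-1/(a_1(\lambda+\gamma-1))$, the limit of this expression, if $\tau=0$); or $a_1=0$ and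 $\tau>\sqrt\gamma\,\|f\|_\phi$. (If $a_1<0$ the set is empty.) Critical value. $\lambda_*(\gamma,\beta):=\inf\bigcup_{f\in L_o^2(\phi)}\mathcal R(f,\gamma,\beta,\cdot)$ (the union is in fact the interval $(\lambda_*(\gamma,\beta),\infty)$). *)

theory Defs
  imports "HOL-Probability.Probability" "HOL-Computational_Algebra.Polynomial"
begin

section \<open>The Gaussian inner product and odd square-integrable functions\<close>

definition gauss_inner :: "(real \<Rightarrow> real) \<Rightarrow> (real \<Rightarrow> real) \<Rightarrow> real" where
  "gauss_inner f g = (LINT z|lborel. f z * g z * std_normal_density z)"

definition gauss_norm :: "(real \<Rightarrow> real) \<Rightarrow> real" where
  "gauss_norm f = sqrt (gauss_inner f f)"

text \<open>Finiteness of the norm is an explicit integrability condition, since the Bochner integral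
  of a non-integrable function is 0.\<close>

definition L2_odd :: "(real \<Rightarrow> real) set" where
  "L2_odd = {f. f \<in> borel_measurable borel \<and> (\<forall>x. f (- x) = - f x) \<and>
     integrable lborel (\<lambda>z. (f z)\<^sup>2 * std_normal_density z)}"


section \<open>Normalized Hermite polynomials\<close>

primrec hermite_poly :: "nat \<Rightarrow> real poly" where
  "hermite_poly 0 = 1"
| "hermite_poly (Suc k) = [:0, 1:] * hermite_poly k - pderiv (hermite_poly k)"

definition hermite :: "nat \<Rightarrow> real \<Rightarrow> real" where
  "hermite k z = poly (hermite_poly k) z / sqrt (fact k)"

text \<open>The recursion above gives the monic Hermite polynomials orthogonal with respect to
  the standard Gaussian; the lemmas \<open>degree_hermite_poly\<close>, \<open>lead_coeff_hermite_poly\<close> and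
  \<open>hermite_orthonormal\<close> below show that \<open>hermite\<close> is the orthonormal system with
  positive leading coefficients.\<close>

lemma degree_lead_hermite_poly:
  "degree (hermite_poly k) = k \<and> lead_coeff (hermite_poly k) = 1"
proof (induction k)
  case (Suc k)
  let ?H = "hermite_poly k"
  have "coeff ?H k = 1" using Suc by metis
  have nz: "?H \<noteq> 0" using Suc by auto
  have d: "degree ([:0, 1:] * ?H) = Suc k" using Suc nz by simp
  have "degree (- pderiv ?H) < degree ([:0, 1:] * ?H)"
    using Suc d by (simp add: degree_pderiv del: mult_pCons_left)
  then have "degree ([:0, 1:] * ?H + - pderiv ?H) = Suc k"
    and "lead_coeff ([:0, 1:] * ?H + - pderiv ?H) = lead_coeff ([:0, 1:] * ?H)"
    using d by (metis degree_add_eq_left) (metis \<open>degree (- pderiv ?H) < _\<close> add.commute lead_coeff_add_le)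
  moreover have "lead_coeff ([:0, 1:] * ?H) = 1"
    unfolding d using \<open>coeff ?H k = 1\<close> by simp
  ultimately show ?case by simp
qed simp

lemmas degree_hermite_poly = degree_lead_hermite_poly [THEN conjunct1]
lemmas lead_coeff_hermite_poly = degree_lead_hermite_poly [THEN conjunct2]

lemma integrable_poly_std_normal: "integrable lborel (\<lambda>z. poly p z * std_normal_density z)"
proof -
  have "integrable lborel (\<lambda>z. \<Sum>i\<le>degree p. coeff p i * (std_normal_density z * z ^ i))"
    by (intro Bochner_Integration.integrable_sum integrable_mult_right integrable_std_normal_moment)
  then show ?thesis
    by (simp add: poly_altdef sum_distrib_left mult_ac)
qed

lemma gauss_moment_step:
  "(LINT z|lborel. std_normal_density z * z ^ Suc n) =
    real n * (LINT z|lborel. std_normal_density z * z ^ (n - 1))"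
proof (cases "even n")
  case True
  then obtain k where k: "n = 2 * k" by auto
  have "real n * (LINT z|lborel. std_normal_density z * z ^ (n - 1)) = 0"
  proof (cases k)
    case (Suc j)
    then have "n - 1 = 2 * j + 1" using k by simp
    then show ?thesis by (simp only: integral_std_normal_moment_odd mult_zero_right)
  qed (use k in simp)
  moreover have "Suc n = 2 * k + 1" using k by simp
  ultimately show ?thesis by (simp only: integral_std_normal_moment_odd)
next
  case False
  then obtain k where k: "n = 2 * k + 1" by (auto elim: oddE)
  have e: "Suc n = 2 * (k + 1)" "n - 1 = 2 * k" using k by auto
  show ?thesis
    unfolding e integral_std_normal_moment_even
  proof -
    have "fact (2 * (k + 1)) = (2 * real (k + 1)) * (real n * fact (2 * k))"
      using k by (simp add: algebra_simps)
    moreover have "2 ^ (k + 1) * fact (k + 1) = (2 * real (k + 1)) * (2 ^ k * fact k :: real)"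
      by (simp add: algebra_simps)
    ultimately show "fact (2 * (k + 1)) / (2 ^ (k + 1) * fact (k + 1)) =
        real n * (fact (2 * k) / (2 ^ k * fact k))"
      by (simp only: mult_divide_mult_cancel_left_if) simp
  qed
qed

lemma gauss_integral_by_parts:
  "(LINT z|lborel. z * poly p z * std_normal_density z) =
    (LINT z|lborel. poly (pderiv p) z * std_normal_density z)"
proof -
  let ?M = "\<lambda>i. LINT z|lborel. std_normal_density z * z ^ i"
  note int = integrable_std_normal_moment
  have "(LINT z|lborel. z * poly p z * std_normal_density z) =
      (LINT z|lborel. (\<Sum>i\<le>degree p. coeff p i * (std_normal_density z * z ^ Suc i)))"
    by (simp add: poly_altdef sum_distrib_left sum_distrib_right mult_ac)
  also have "\<dots> = (\<Sum>i\<le>degree p. coeff p i * ?M (Suc i))"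
    by (subst Bochner_Integration.integral_sum)
      (simp_all only: int integrable_mult_right integral_mult_right_zero)
  also have "\<dots> = (\<Sum>i\<le>degree p. coeff p i * (real i * ?M (i - 1)))"
    by (simp only: gauss_moment_step)
  also have "\<dots> = (\<Sum>i\<in>{1..degree p}. coeff p i * (real i * ?M (i - 1)))"
    by (rule sum.mono_neutral_right) (auto simp: Suc_le_eq)
  also have "\<dots> = (\<Sum>i<degree p. coeff (pderiv p) i * ?M i)"
    by (rule sum.reindex_bij_witness[of _ Suc "\<lambda>i. i - 1"]) (auto simp: coeff_pderiv)
  also have "\<dots> = (\<Sum>i\<le>degree (pderiv p). coeff (pderiv p) i * ?M i)"
    by (cases "degree p = 0")
      (auto simp: degree_pderiv coeff_pderiv coeff_eq_0 intro!: sum.cong)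
  also have "\<dots> = (LINT z|lborel. (\<Sum>i\<le>degree (pderiv p).
      coeff (pderiv p) i * (std_normal_density z * z ^ i)))"
    by (subst Bochner_Integration.integral_sum)
      (simp_all only: int integrable_mult_right integral_mult_right_zero)
  also have "\<dots> = (LINT z|lborel. poly (pderiv p) z * std_normal_density z)"
    by (simp add: poly_altdef sum_distrib_left sum_distrib_right mult_ac)
  finally show ?thesis .
qed

lemma pderiv_hermite_poly: "pderiv (hermite_poly (Suc k)) = smult (real (Suc k)) (hermite_poly k)"
proof (induction k)
  case 0
  show ?case by (simp add: pderiv_pCons one_pCons)
next
  case (Suc k)
  let ?c = "real (Suc k)"
  have "pderiv (hermite_poly (Suc (Suc k))) =
      hermite_poly (Suc k) + [:0, 1:] * pderiv (hermite_poly (Suc k))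
        - pderiv (pderiv (hermite_poly (Suc k)))"
    by (simp only: hermite_poly.simps(2)[of "Suc k"] pderiv_diff pderiv_mult)
      (simp add: pderiv_pCons del: hermite_poly.simps)
  also have "\<dots> = hermite_poly (Suc k) + smult ?c ([:0, 1:] * hermite_poly k - pderiv (hermite_poly k))"
    by (simp only: Suc.IH pderiv_smult mult_smult_right smult_diff_right add_diff_eq)
  also have "\<dots> = smult 1 (hermite_poly (Suc k)) + smult ?c (hermite_poly (Suc k))"
    by simp
  also have "\<dots> = smult (real (Suc (Suc k))) (hermite_poly (Suc k))"
    by (simp only: smult_add_left [symmetric]) simp
  finally show ?case .
qed

lemma hermite_poly_adjoint:
  "(LINT z|lborel. poly (hermite_poly (Suc k) * p) z * std_normal_density z) =
    (LINT z|lborel. poly (hermite_poly k * pderiv p) z * std_normal_density z)"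
proof -
  let ?H = "hermite_poly k" and ?w = std_normal_density
  have "(LINT z|lborel. poly (hermite_poly (Suc k) * p) z * ?w z) =
      (LINT z|lborel. z * poly (?H * p) z * ?w z - poly (pderiv ?H * p) z * ?w z)"
    by (simp add: algebra_simps)
  also have "\<dots> = (LINT z|lborel. z * poly (?H * p) z * ?w z)
      - (LINT z|lborel. poly (pderiv ?H * p) z * ?w z)"
    using integrable_poly_std_normal[of "[:0, 1:] * (?H * p)"]
      integrable_poly_std_normal[of "pderiv ?H * p"]
    by (intro Bochner_Integration.integral_diff) simp_all
  also have "\<dots> = (LINT z|lborel. poly (pderiv (?H * p)) z * ?w z)
      - (LINT z|lborel. poly (pderiv ?H * p) z * ?w z)"
    by (simp only: gauss_integral_by_parts)
  also have "\<dots> = (LINT z|lborel. poly (pderiv (?H * p)) z * ?w z - poly (pderiv ?H * p) z * ?w z)"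
    by (intro Bochner_Integration.integral_diff [symmetric] integrable_poly_std_normal)
  also have "\<dots> = (LINT z|lborel. poly (?H * pderiv p) z * ?w z)"
    by (rule arg_cong[where f = "integral\<^sup>L lborel"]) (auto simp: pderiv_mult algebra_simps)
  finally show ?thesis .
qed

lemma hermite_poly_orthogonal:
  "(LINT z|lborel. poly (hermite_poly k * hermite_poly l) z * std_normal_density z) =
    (if k = l then fact k else 0)"
proof (induction k arbitrary: l)
  case 0
  show ?case
  proof (cases l)
    case 0
    then show ?thesis using integral_std_normal_moment_even[of 0] by simp
  next
    case (Suc m)
    then show ?thesis using hermite_poly_adjoint[of m 1] by (simp add: mult.commute)
  qed
next
  case (Suc k)
  show ?case
  proof (cases l)
    case 0
    then show ?thesis using hermite_poly_adjoint[of k 1] by simp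
  next
    case l: (Suc m)
    have "(LINT z|lborel. poly (hermite_poly (Suc k) * hermite_poly (Suc m)) z
          * std_normal_density z) =
        (LINT z|lborel. real (Suc m) *
          (poly (hermite_poly k * hermite_poly m) z * std_normal_density z))"
      unfolding hermite_poly_adjoint pderiv_hermite_poly
      by (simp add: mult_ac del: of_nat_Suc)
    also have "\<dots> = real (Suc m) * (if k = m then fact k else 0)"
      by (simp only: integral_mult_right_zero Suc.IH)
    finally show ?thesis using l by (simp add: algebra_simps)
  qed
qed

lemma hermite_orthonormal: "gauss_inner (hermite k) (hermite l) = (if k = l then 1 else 0)"
proof -
  have "gauss_inner (hermite k) (hermite l) =
      (LINT z|lborel. (poly (hermite_poly k * hermite_poly l) z * std_normal_density z)
        / (sqrt (fact k) * sqrt (fact l)))"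
    by (simp add: gauss_inner_def hermite_def)
  also have "\<dots> = (if k = l then 1 else 0)"
    by (simp only: integral_divide_zero hermite_poly_orthogonal) simp
  finally show ?thesis .
qed


section \<open>Recovery region and critical value\<close>

definition hermite_coeff :: "(real \<Rightarrow> real) \<Rightarrow> nat \<Rightarrow> real" where
  "hermite_coeff f k = gauss_inner f (hermite k)"

text \<open>The sum over degrees at least 3 is indexed from 0, the degree being \<open>j + 3\<close>.\<close>

definition tau :: "(real \<Rightarrow> real) \<Rightarrow> real \<Rightarrow> real \<Rightarrow> real" where
  "tau f \<beta> \<Lambda> =
    (\<Sum>j. hermite_coeff f (j + 3) * (\<Lambda> - 1) ^ (j + 3) / (sqrt (fact (j + 3)) * \<beta> ^ (j + 2)))"

definition psi' :: "(real \<Rightarrow> real) \<Rightarrow> real \<Rightarrow> real \<Rightarrow> real" where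
  "psi' f \<gamma> s = (let a = hermite_coeff f 1 in
     1 / s\<^sup>2 - a\<^sup>2 * \<gamma> / (1 + a * \<gamma> * s)\<^sup>2 - \<gamma> * ((gauss_norm f)\<^sup>2 - a\<^sup>2))"

definition s_plus :: "(real \<Rightarrow> real) \<Rightarrow> real \<Rightarrow> real \<Rightarrow> real \<Rightarrow> real" where
  "s_plus f \<gamma> \<beta> \<Lambda> = (let a = hermite_coeff f 1; t = tau f \<beta> \<Lambda> in
     if t = 0 then - 1 / (a * (\<Lambda> + \<gamma> - 1))
     else (- a * (\<Lambda> + \<gamma> - 1) - t + sqrt ((a * (\<Lambda> + \<gamma> - 1) + t)\<^sup>2 - 4 * a * \<gamma> * t))
       / (2 * a * \<gamma> * t))"

definition recovery_region :: "(real \<Rightarrow> real) \<Rightarrow> real \<Rightarrow> real \<Rightarrow> real set" where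
  "recovery_region f \<gamma> \<beta> = {\<Lambda>. \<Lambda> > 1 \<and>
     (hermite_coeff f 1 > 0 \<and> psi' f \<gamma> (s_plus f \<gamma> \<beta> \<Lambda>) > 0 \<or>
      hermite_coeff f 1 = 0 \<and> tau f \<beta> \<Lambda> > sqrt \<gamma> * gauss_norm f)}"

text \<open>For positive arguments the infimum below is over a set of reals that is nonempty and
  bounded below by 1; see \<open>recovery_region_Union_nonempty\<close> and \<open>recovery_region_bdd_below\<close>.\<close>

definition lambda_star :: "real \<Rightarrow> real \<Rightarrow> real" where
  "lambda_star \<gamma> \<beta> = Inf (\<Union>f\<in>L2_odd. recovery_region f \<gamma> \<beta>)"

lemma recovery_region_bdd_below: "bdd_below (\<Union>f\<in>L2_odd. recovery_region f \<gamma> \<beta>)"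
  by (rule bdd_belowI[of _ 1]) (auto simp: recovery_region_def)

lemma recovery_region_Union_nonempty:
  assumes "\<gamma> > 0"
  shows "(\<Union>f\<in>L2_odd. recovery_region f \<gamma> \<beta>) \<noteq> {}"
proof -
  have id: "hermite 1 = (\<lambda>x. x)"
    by (auto simp: hermite_def)
  have odd: "(\<lambda>x. x) \<in> L2_odd"
    using integrable_poly_std_normal[of "[:0, 0, 1:]"]
    by (simp add: L2_odd_def power2_eq_square)
  have c: "hermite_coeff (\<lambda>x. x) k = (if k = 1 then 1 else 0)" for k
    using hermite_orthonormal[of 1 k] by (simp only: hermite_coeff_def id) auto
  have n: "gauss_norm (\<lambda>x. x) = 1"
    using hermite_orthonormal[of 1 1] by (simp only: gauss_norm_def id) simp
  have t: "tau (\<lambda>x. x) \<beta> \<Lambda> = 0" for \<Lambda>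
    by (simp add: tau_def c)
  define m where "m = sqrt \<gamma> + 1"
  have m: "m > 0" "m\<^sup>2 > \<gamma>"
    using assms by (auto simp: m_def power2_eq_square algebra_simps add_pos_pos intro: add_nonneg_pos)
  have "1 + \<gamma> * (- 1 / (m + \<gamma>)) = m / (m + \<gamma>)"
    using m assms by (simp add: field_simps)
  then have "psi' (\<lambda>x. x) \<gamma> (s_plus (\<lambda>x. x) \<gamma> \<beta> (1 + m)) =
      1 / (- 1 / (m + \<gamma>))\<^sup>2 - \<gamma> / (m / (m + \<gamma>))\<^sup>2"
    by (simp add: psi'_def s_plus_def Let_def c t n)
  also have "\<dots> = (m + \<gamma>)\<^sup>2 * (m\<^sup>2 - \<gamma>) / m\<^sup>2"
    using m assms by (simp add: field_simps)
  also have "\<dots> > 0"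
    using m assms by simp
  finally have "1 + m \<in> recovery_region (\<lambda>x. x) \<gamma> \<beta>"
    using m by (simp add: recovery_region_def c)
  then show ?thesis using odd by blast
qed

end

theory Submission
  imports Defs "HOL-Real_Asymp.Real_Asymp"
begin

text \<open>The critical value has the closed form
  \<open>lambda_star \<gamma> \<beta> = 1 + \<beta> * sqrt (arsinh (\<gamma> / \<beta>\<^sup>2))\<close>. Put \<open>m = \<Lambda> - 1\<close> and
  \<open>T = \<beta>\<^sup>2 * sinh (m\<^sup>2 / \<beta>\<^sup>2) - m\<^sup>2\<close>. Since odd \<open>f\<close> has no even Hermite coefficients,
  Bessel and Cauchy-Schwarz give \<open>\<tau>\<^sup>2 \<le> b * T\<close> with \<open>b = \<parallel>f\<parallel>\<^sup>2 - a\<^sup>2\<close> and \<open>a = a\<^sub>1\<close>, and this is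
  sharp up to truncating the extremal \<open>f\<close>. Writing \<open>s\<^sub>+ = - 1 / (v + a * \<gamma>)\<close>, the quadratic
  equation for \<open>s\<^sub>+\<close> becomes \<open>\<tau> * v = (v + a * \<gamma>) * (v - a * m)\<close> with \<open>v > 0\<close>, and
  \<open>\<psi>'(s\<^sub>+) > 0\<close> becomes \<open>(v + a * \<gamma>)\<^sup>2 * (v\<^sup>2 - a\<^sup>2 * \<gamma>) / v\<^sup>2 > \<gamma> * b\<close>. Eliminating \<open>\<tau>\<close> and \<open>b\<close>,
  some \<open>f\<close> recovers iff \<open>T * (v\<^sup>2 - a\<^sup>2 * \<gamma>) > \<gamma> * (v - a * m)\<^sup>2\<close> has a solution, and for \<open>m\<^sup>2 < \<gamma>\<close>
  the best choice \<open>v = a * \<gamma> / m\<close> turns this into \<open>m\<^sup>2 + T > \<gamma>\<close>, that is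
  \<open>\<beta>\<^sup>2 * sinh (m\<^sup>2 / \<beta>\<^sup>2) > \<gamma>\<close>.\<close>

section \<open>Hermite coefficients of odd functions\<close>

text \<open>Oddness is dropped so that every \<open>hermite k\<close>, of even or odd degree, is a
  member.\<close>

definition L2_gauss :: "(real \<Rightarrow> real) set" where
  "L2_gauss = {f \<in> borel_measurable borel. integrable lborel (\<lambda>z. (f z)\<^sup>2 * std_normal_density z)}"

lemma L2_odd_subset: "L2_odd \<subseteq> L2_gauss"
  by (auto simp: L2_odd_def L2_gauss_def)

lemma integrable_L2_gauss_mult:
  assumes "f \<in> L2_gauss" "g \<in> L2_gauss"
  shows "integrable lborel (\<lambda>z. f z * g z * std_normal_density z)"
proof (rule Bochner_Integration.integrable_bound)
  show "integrable lborel (\<lambda>z. (f z)\<^sup>2 * std_normal_density z + (g z)\<^sup>2 * std_normal_density z)"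
    using assms by (auto simp: L2_gauss_def)
  have [measurable]: "f \<in> borel_measurable borel" "g \<in> borel_measurable borel"
    using assms by (auto simp: L2_gauss_def)
  show "(\<lambda>z. f z * g z * std_normal_density z) \<in> borel_measurable lborel"
    by measurable
  have "\<bar>x * y\<bar> \<le> x\<^sup>2 + y\<^sup>2" for x y :: real
    using sum_squares_bound[of "\<bar>x\<bar>" "\<bar>y\<bar>"] abs_ge_zero[of "x * y"]
    unfolding abs_mult power2_abs by linarith
  then have "\<bar>f z * g z\<bar> * std_normal_density z \<le> ((f z)\<^sup>2 + (g z)\<^sup>2) * std_normal_density z" for z
    by (intro mult_right_mono) auto
  then show "AE z in lborel. norm (f z * g z * std_normal_density z) \<le>
      norm ((f z)\<^sup>2 * std_normal_density z + (g z)\<^sup>2 * std_normal_density z)"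
    by (auto simp: abs_mult algebra_simps)
qed

lemma L2_gauss_add:
  assumes "f \<in> L2_gauss" "g \<in> L2_gauss"
  shows "(\<lambda>z. f z + g z) \<in> L2_gauss"
proof -
  have "integrable lborel (\<lambda>z. (f z)\<^sup>2 * std_normal_density z + (g z)\<^sup>2 * std_normal_density z
      + 2 * (f z * g z * std_normal_density z))"
    using assms integrable_L2_gauss_mult[OF assms] by (auto simp: L2_gauss_def)
  moreover have "(\<lambda>z. f z + g z) \<in> borel_measurable borel"
    using assms by (auto simp: L2_gauss_def)
  ultimately show ?thesis
    by (simp add: L2_gauss_def power2_sum algebra_simps)
qed

lemma L2_gauss_cmult: "f \<in> L2_gauss \<Longrightarrow> (\<lambda>z. c * f z) \<in> L2_gauss"
  by (auto simp: L2_gauss_def power_mult_distrib mult.assoc)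

lemma L2_gauss_sum:
  "finite I \<Longrightarrow> (\<And>i. i \<in> I \<Longrightarrow> f i \<in> L2_gauss) \<Longrightarrow> (\<lambda>z. \<Sum>i\<in>I. f i z) \<in> L2_gauss"
  by (induction I rule: finite_induct) (simp add: L2_gauss_def, simp add: L2_gauss_add)

lemma hermite_L2_gauss: "hermite k \<in> L2_gauss"
proof -
  have "integrable lborel (\<lambda>z. poly (hermite_poly k * hermite_poly k) z * std_normal_density z / fact k)"
    by (intro integrable_divide integrable_poly_std_normal)
  moreover have "hermite k \<in> borel_measurable borel"
    unfolding hermite_def[abs_def]
    by (intro borel_measurable_continuous_onI continuous_intros) simp
  ultimately show ?thesis
    by (simp add: L2_gauss_def hermite_def power_divide power2_eq_square)
qed

section \<open>Inner products and Bessel's inequality\<close>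

lemma gauss_inner_commute: "gauss_inner f g = gauss_inner g f"
  by (simp add: gauss_inner_def mult_ac)

lemma gauss_inner_sum_left:
  assumes "\<And>i. i \<in> I \<Longrightarrow> f i \<in> L2_gauss" "g \<in> L2_gauss"
  shows "gauss_inner (\<lambda>z. \<Sum>i\<in>I. c i * f i z) g = (\<Sum>i\<in>I. c i * gauss_inner (f i) g)"
proof -
  have "gauss_inner (\<lambda>z. \<Sum>i\<in>I. c i * f i z) g =
      (LINT z|lborel. (\<Sum>i\<in>I. c i * (f i z * g z * std_normal_density z)))"
    by (simp add: gauss_inner_def sum_distrib_right mult.assoc)
  also have "\<dots> = (\<Sum>i\<in>I. (LINT z|lborel. c i * (f i z * g z * std_normal_density z)))"
    using assms by (intro Bochner_Integration.integral_sum integrable_mult_right integrable_L2_gauss_mult)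
  finally show ?thesis
    by (simp add: gauss_inner_def)
qed

lemma gauss_norm_square: "(gauss_norm f)\<^sup>2 = gauss_inner f f"
  by (auto simp: gauss_norm_def gauss_inner_def intro!: Bochner_Integration.integral_nonneg)

lemma gauss_inner_hermite_left: "gauss_inner (hermite k) f = hermite_coeff f k"
  unfolding hermite_coeff_def by (rule gauss_inner_commute)

lemma mult_gauss_inner_hermite:
  "c * gauss_inner (hermite k) (hermite l) = (if k = l then c else 0)"
  by (simp add: hermite_orthonormal)

text \<open>Expands the nonnegative integral of \<open>(f z - p z)\<^sup>2\<close>, where
  \<open>p\<close> is the projection of \<open>f\<close> onto the chosen Hermite functions:
  \<open>gauss_inner p f\<close> and \<open>gauss_inner p p\<close> both equal the sum on the
  left.\<close>

lemma bessel_hermite: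
  assumes f: "f \<in> L2_gauss" and I: "finite I"
  shows "(\<Sum>k\<in>I. (hermite_coeff f k)\<^sup>2) \<le> (gauss_norm f)\<^sup>2"
proof -
  define p where "p = (\<lambda>z. \<Sum>k\<in>I. hermite_coeff f k * hermite k z)"
  have p: "p \<in> L2_gauss"
    unfolding p_def by (intro L2_gauss_sum I L2_gauss_cmult hermite_L2_gauss)
  have pg: "gauss_inner p g = (\<Sum>k\<in>I. hermite_coeff f k * gauss_inner (hermite k) g)"
    if "g \<in> L2_gauss" for g
    unfolding p_def using that by (intro gauss_inner_sum_left hermite_L2_gauss)
  have pf: "gauss_inner p f = (\<Sum>k\<in>I. (hermite_coeff f k)\<^sup>2)"
    using pg[OF f] by (simp add: gauss_inner_hermite_left power2_eq_square)
  have ph: "hermite_coeff p k = hermite_coeff f k" if "k \<in> I" for k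
    using that I pg[OF hermite_L2_gauss[of k]]
    by (simp add: hermite_coeff_def mult_gauss_inner_hermite)
  have pp: "gauss_inner p p = (\<Sum>k\<in>I. (hermite_coeff f k)\<^sup>2)"
    using pg[OF p] by (simp add: gauss_inner_hermite_left ph power2_eq_square)
  note int = integrable_L2_gauss_mult[OF f f] integrable_L2_gauss_mult[OF p p]
    integrable_L2_gauss_mult[OF p f]
  have "0 \<le> (LINT z|lborel. (f z - p z)\<^sup>2 * std_normal_density z)"
    by (intro Bochner_Integration.integral_nonneg) simp
  also have "\<dots> = (LINT z|lborel. f z * f z * std_normal_density z
      + p z * p z * std_normal_density z - 2 * (p z * f z * std_normal_density z))"
    by (simp add: power2_eq_square algebra_simps)
  also have "\<dots> = gauss_inner f f + gauss_inner p p - 2 * gauss_inner p f"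
    using int by (simp add: gauss_inner_def)
  finally show ?thesis
    by (simp add: pp pf gauss_norm_square)
qed

section \<open>Parity\<close>

lemma hermite_poly_pcompose_uminus:
  "pcompose (hermite_poly k) [:0, -1:] = smult ((-1) ^ k) (hermite_poly k)"
proof (induction k)
  case (Suc k)
  have "smult (-1) (pcompose (pderiv (hermite_poly k)) [:0, -1:]) = smult ((-1) ^ k) (pderiv (hermite_poly k))"
    using arg_cong[OF Suc.IH, of pderiv]
    by (simp add: pderiv_pcompose pderiv_smult pderiv_pCons)
  then have "pcompose (pderiv (hermite_poly k)) [:0, -1:] = - smult ((-1) ^ k) (pderiv (hermite_poly k))"
    by (metis add.inverse_inverse smult_1_left smult_minus_left)
  then show ?case
    using Suc.IH by (simp add: pcompose_diff pcompose_mult pcompose_pCons smult_diff_right)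
qed (simp add: pcompose_1)

lemma hermite_uminus: "hermite k (- x) = (-1) ^ k * hermite k x"
  using arg_cong[OF hermite_poly_pcompose_uminus[of k], of "\<lambda>p. poly p x"]
  by (simp add: hermite_def poly_pcompose)

text \<open>The substitution of \<open>- z\<close> for \<open>z\<close> negates the integral:
  \<open>f\<close> is odd, while \<open>hermite k\<close> and the density are even.\<close>

lemma hermite_coeff_odd_even:
  assumes "\<And>x. f (- x) = - f x" "even k"
  shows "hermite_coeff f k = 0"
proof -
  have "hermite_coeff f k = (LINT z|lborel. f (- z) * hermite k (- z) * std_normal_density (- z))"
    using lborel_integral_real_affine[of "-1" "\<lambda>z. f z * hermite k z * std_normal_density z" 0]
    by (simp add: hermite_coeff_def gauss_inner_def)
  also have "\<dots> = - hermite_coeff f k"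
    using assms by (simp add: hermite_coeff_def gauss_inner_def hermite_uminus normal_density_def)
  finally show ?thesis by simp
qed

text \<open>Supplies the test functions for sufficiency: finitely many coefficients in odd degrees
  can be prescribed at will.\<close>

lemma hermite_combination:
  fixes c :: "nat \<Rightarrow> real" and n :: nat
  assumes c: "\<And>k. even k \<Longrightarrow> c k = 0"
  defines "f \<equiv> \<lambda>z. \<Sum>k<n. c k * hermite k z"
  shows "f \<in> L2_odd"
    and "hermite_coeff f k = (if k < n then c k else 0)"
    and "(gauss_norm f)\<^sup>2 = (\<Sum>k<n. (c k)\<^sup>2)"
proof -
  have L2: "f \<in> L2_gauss"
    unfolding f_def by (intro L2_gauss_sum L2_gauss_cmult hermite_L2_gauss) simp
  have "c k * hermite k (- z) = - (c k * hermite k z)" for k z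
    using c[of k] by (cases "even k") (auto simp: hermite_uminus)
  then show "f \<in> L2_odd"
    using L2 by (auto simp: L2_odd_def L2_gauss_def f_def sum_negf)
  have inner: "gauss_inner f g = (\<Sum>k<n. c k * gauss_inner (hermite k) g)" if "g \<in> L2_gauss" for g
    unfolding f_def using that by (intro gauss_inner_sum_left hermite_L2_gauss)
  show coeff: "hermite_coeff f k = (if k < n then c k else 0)" for k
    using inner[OF hermite_L2_gauss[of k]] by (auto simp: hermite_coeff_def mult_gauss_inner_hermite)
  show "(gauss_norm f)\<^sup>2 = (\<Sum>k<n. (c k)\<^sup>2)"
    unfolding gauss_norm_square inner[OF L2]
    by (simp add: gauss_inner_hermite_left coeff power2_eq_square)
qed

section \<open>Monotonicity and limit of the closed form\<close>

text \<open>The difference of the two sides vanishes at 0 and has derivative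
  \<open>c * (cosh (c * y) - cosh y)\<close>, which is positive.\<close>

lemma sinh_mult_gt:
  fixes x c :: real
  assumes "x > 0" "c > 1"
  shows "c * sinh x < sinh (c * x)"
proof -
  have "(\<lambda>x. sinh (c * x) - c * sinh x) 0 < (\<lambda>x. sinh (c * x) - c * sinh x) x"
  proof (rule DERIV_pos_imp_increasing_open[OF assms(1)])
    fix y :: real assume y: "0 < y" "y < x"
    have "cosh y < cosh (c * y)"
      using y assms by (subst cosh_real_nonneg_less_iff) auto
    then show "\<exists>D. ((\<lambda>x. sinh (c * x) - c * sinh x) has_real_derivative D) (at y) \<and> 0 < D"
      using assms by (intro exI[of _ "c * cosh (c * y) - c * cosh y"])
        (auto intro!: derivative_eq_intros)
  qed (auto intro!: continuous_intros)
  then show ?thesis by simp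
qed

lemma arsinh_div_decreasing:
  fixes x y :: real
  assumes "0 < x" "x < y"
  shows "arsinh y / y < arsinh x / x"
proof -
  have "y / x * sinh (arsinh x) < sinh (y / x * arsinh x)"
    using assms by (intro sinh_mult_gt) auto
  then have "sinh (arsinh y) < sinh (y / x * arsinh x)"
    using assms by simp
  then have "arsinh y < y / x * arsinh x"
    by (subst (asm) sinh_real_less_iff)
  then show ?thesis
    using assms by (simp add: field_simps)
qed

text \<open>Doubling makes the weak bound strict:
  \<open>x \<le> 2 * sinh (x / 2) < sinh x\<close>.\<close>

lemma less_sinh:
  fixes x :: real
  assumes "x > 0"
  shows "x < sinh x"
  using sinh_mult_gt[of "x / 2" 2] real_le_x_sinh[of "x / 2"] assms
  by (simp add: sinh_field_def exp_minus)

text \<open>For positive arguments, this is the positive solution \<open>m\<close> of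
  \<open>\<beta>\<^sup>2 * sinh (m\<^sup>2 / \<beta>\<^sup>2) = \<gamma>\<close>.\<close>

definition region_edge :: "real \<Rightarrow> real \<Rightarrow> real" where
  "region_edge \<gamma> \<beta> = \<beta> * sqrt (arsinh (\<gamma> / \<beta>\<^sup>2))"

lemma strict_mono_region_edge:
  assumes "\<gamma> > 0"
  shows "strict_mono_on {0<..} (region_edge \<gamma>)"
proof (rule strict_mono_onI)
  fix b c :: real assume bc: "b \<in> {0<..}" "c \<in> {0<..}" "b < c"
  \<comment> \<open>With \<open>y = \<gamma> / x\<^sup>2\<close>, growth in \<open>x\<close> reduces
    to the decrease of \<open>arsinh y / y\<close> in \<open>y\<close>.\<close>
  have eq: "region_edge \<gamma> x = sqrt (\<gamma> * (arsinh (\<gamma> / x\<^sup>2) / (\<gamma> / x\<^sup>2)))" if "x > 0" for x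
    using that assms by (simp add: region_edge_def real_sqrt_mult)
  have "b\<^sup>2 < c\<^sup>2" using bc by (intro power_strict_mono) auto
  then have "arsinh (\<gamma> / b\<^sup>2) / (\<gamma> / b\<^sup>2) < arsinh (\<gamma> / c\<^sup>2) / (\<gamma> / c\<^sup>2)"
    using bc assms by (intro arsinh_div_decreasing divide_strict_left_mono) auto
  then show "region_edge \<gamma> b < region_edge \<gamma> c"
    using assms bc eq[of b] eq[of c]
    by (simp only: real_sqrt_less_iff mult_less_cancel_left_pos greaterThan_iff)
qed

lemma region_edge_tendsto:
  assumes "\<gamma> > 0"
  shows "(region_edge \<gamma> \<longlongrightarrow> sqrt \<gamma>) at_top"
proof -
  have "((\<lambda>\<beta>. \<beta> * sqrt (ln (\<gamma> / \<beta>\<^sup>2 + sqrt ((\<gamma> / \<beta>\<^sup>2)\<^sup>2 + 1)))) \<longlongrightarrow> sqrt \<gamma>) at_top"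
    using assms by real_asymp (simp add: powr_half_sqrt)
  then show ?thesis
    by (simp add: region_edge_def[abs_def] arsinh_real_def)
qed

lemma region_edge_pos: "\<gamma> > 0 \<Longrightarrow> \<beta> > 0 \<Longrightarrow> region_edge \<gamma> \<beta> > 0"
  by (simp add: region_edge_def)

lemma less_sinh_iff_region_edge_less:
  assumes "\<gamma> > 0" "\<beta> > 0" "m > 0"
  shows "\<gamma> < \<beta>\<^sup>2 * sinh (m\<^sup>2 / \<beta>\<^sup>2) \<longleftrightarrow> region_edge \<gamma> \<beta> < m"
proof -
  have "arsinh (\<gamma> / \<beta>\<^sup>2) > 0" using assms by simp
  then have edge: "(region_edge \<gamma> \<beta>)\<^sup>2 = \<beta>\<^sup>2 * arsinh (\<gamma> / \<beta>\<^sup>2)"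
    by (simp only: region_edge_def power_mult_distrib real_sqrt_pow2 less_imp_le)
  have "\<gamma> < \<beta>\<^sup>2 * sinh (m\<^sup>2 / \<beta>\<^sup>2) \<longleftrightarrow> sinh (arsinh (\<gamma> / \<beta>\<^sup>2)) < sinh (m\<^sup>2 / \<beta>\<^sup>2)"
    using assms by (simp add: field_simps)
  also have "\<dots> \<longleftrightarrow> (region_edge \<gamma> \<beta>)\<^sup>2 < m\<^sup>2"
    using assms edge by (subst sinh_real_less_iff) (simp add: field_simps)
  also have "\<dots> \<longleftrightarrow> region_edge \<gamma> \<beta> < m"
    using assms region_edge_pos[of \<gamma> \<beta>] by (simp add: power_mono_iff flip: not_le)
  finally show ?thesis .
qed

text \<open>Leaves room between the edge and \<open>sqrt \<gamma>\<close> for the sufficiency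
  construction, which needs \<open>m\<^sup>2 < \<gamma>\<close>.\<close>

lemma region_edge_less_sqrt:
  assumes "\<gamma> > 0" "\<beta> > 0"
  shows "region_edge \<gamma> \<beta> < sqrt \<gamma>"
proof -
  have "\<gamma> / \<beta>\<^sup>2 < sinh (\<gamma> / \<beta>\<^sup>2)"
    using assms by (intro less_sinh) simp
  then have "\<gamma> < \<beta>\<^sup>2 * sinh ((sqrt \<gamma>)\<^sup>2 / \<beta>\<^sup>2)"
    using assms by (simp add: field_simps)
  then show ?thesis
    using less_sinh_iff_region_edge_less[of \<gamma> \<beta> "sqrt \<gamma>"] assms by simp
qed

section \<open>The recovery condition\<close>

text \<open>For nonzero \<open>t\<close>, \<open>s_plus\<close> is a root of
  \<open>a * \<gamma> * t * s\<^sup>2 + (A + t) * s + 1 = 0\<close>; putting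
  \<open>s = - 1 / u\<close> and \<open>u = v + a * \<gamma>\<close> yields the hypothesis on
  \<open>v\<close>. Positivity of \<open>v\<close> selects the right root.\<close>

lemma s_plus_eq:
  assumes a: "hermite_coeff f 1 = a" "a > 0" and "\<gamma> > 0" "\<Lambda> > 1" "v > 0"
    and v: "tau f \<beta> \<Lambda> * v = (v + a * \<gamma>) * (v - a * (\<Lambda> - 1))"
  shows "s_plus f \<gamma> \<beta> \<Lambda> = - 1 / (v + a * \<gamma>)"
proof -
  define t where "t = tau f \<beta> \<Lambda>"
  define A where "A = a * (\<Lambda> + \<gamma> - 1)"
  define u where "u = v + a * \<gamma>"
  have u: "u > 0" using assms by (simp add: u_def add_pos_pos)
  have q: "u\<^sup>2 - (A + t) * u + a * \<gamma> * t = 0"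
    using v by (simp add: u_def A_def t_def power2_eq_square algebra_simps)
  show ?thesis
  proof (cases "t = 0")
    case True
    then have "v = a * (\<Lambda> - 1)"
      using v u by (simp add: t_def u_def)
    then show ?thesis using True
      using a by (simp add: s_plus_def Let_def t_def algebra_simps)
  next
    case False
    \<comment> \<open>By Vieta, \<open>A + t - u - a * \<gamma>\<close> is the other root of the
      quadratic in \<open>v\<close>, and the product of the roots is negative. So \<open>u\<close>
      is the larger root of its own quadratic, which fixes the sign of the square root.\<close>
    have "v * (A + t - u - a * \<gamma>) = - (a * \<gamma> * (a * (\<Lambda> - 1)))"
      using v by (simp add: u_def A_def t_def algebra_simps)
    moreover have "0 < a * \<gamma> * (a * (\<Lambda> - 1))" using assms by simp
    ultimately have "v * (A + t - u - a * \<gamma>) < 0" by linarith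
    then have "A + t - u - a * \<gamma> < 0"
      using \<open>v > 0\<close> by (simp add: mult_less_0_iff)
    then have nn: "2 * u - (A + t) \<ge> 0"
      using \<open>v > 0\<close> by (simp add: u_def algebra_simps)
    have "(A + t)\<^sup>2 - 4 * a * \<gamma> * t = (2 * u - (A + t))\<^sup>2"
      using q by (simp add: power2_eq_square algebra_simps)
    then have "sqrt ((A + t)\<^sup>2 - 4 * a * \<gamma> * t) = 2 * u - (A + t)"
      using nn by simp
    then have "s_plus f \<gamma> \<beta> \<Lambda> = (- A - t + (2 * u - (A + t))) / (2 * a * \<gamma> * t)"
      using False by (simp add: s_plus_def Let_def a[simplified] flip: t_def A_def)
    also have "\<dots> = - 1 / u"
      using q u False assms by (simp add: divide_simps) (simp add: power2_eq_square algebra_simps)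
    finally show ?thesis by (simp add: u_def)
  qed
qed

lemma psi'_eq:
  assumes "hermite_coeff f 1 = a" "a > 0" "\<gamma> > 0" "v > 0"
  shows "psi' f \<gamma> (- 1 / (v + a * \<gamma>)) =
    (v + a * \<gamma>)\<^sup>2 * (v\<^sup>2 - a\<^sup>2 * \<gamma>) / v\<^sup>2 - \<gamma> * ((gauss_norm f)\<^sup>2 - a\<^sup>2)"
proof -
  have u: "v + a * \<gamma> > 0" using assms by (simp add: add_pos_pos)
  then have "1 + a * \<gamma> * (- 1 / (v + a * \<gamma>)) = v / (v + a * \<gamma>)"
    by (simp add: field_simps)
  then have "psi' f \<gamma> (- 1 / (v + a * \<gamma>)) = 1 / (- 1 / (v + a * \<gamma>))\<^sup>2
      - a\<^sup>2 * \<gamma> / (v / (v + a * \<gamma>))\<^sup>2 - \<gamma> * ((gauss_norm f)\<^sup>2 - a\<^sup>2)"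
    by (simp only: psi'_def Let_def assms(1))
  also have "1 / (- 1 / (v + a * \<gamma>))\<^sup>2 - a\<^sup>2 * \<gamma> / (v / (v + a * \<gamma>))\<^sup>2
      = (v + a * \<gamma>)\<^sup>2 * (v\<^sup>2 - a\<^sup>2 * \<gamma>) / v\<^sup>2"
    using u \<open>v > 0\<close> by (simp add: power_divide field_simps)
  finally show ?thesis .
qed

text \<open>As a quadratic in \<open>v\<close> this has constant term \<open>- q < 0\<close>, hence
  a positive root whatever the sign of \<open>t\<close>.\<close>

lemma ex_pos_root:
  fixes a m \<gamma> t :: real
  assumes "a > 0" "m > 0" "\<gamma> > 0"
  obtains v where "v > 0" "t * v = (v + a * \<gamma>) * (v - a * m)"
proof -
  define p where "p = a * m + t - a * \<gamma>"
  define q where "q = a * \<gamma> * (a * m)"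
  define v where "v = (p + sqrt (p\<^sup>2 + 4 * q)) / 2"
  have q: "q > 0" using assms by (simp add: q_def)
  have "\<bar>p\<bar> < sqrt (p\<^sup>2 + 4 * q)"
    using q by (intro real_less_rsqrt) auto
  then have "v > 0" by (simp add: v_def)
  have "(2 * v - p)\<^sup>2 = p\<^sup>2 + 4 * q"
    using q by (simp add: v_def diff_divide_distrib add_divide_distrib)
  then have "v * v = p * v + q" by (simp add: power2_eq_square algebra_simps)
  then have "t * v = (v + a * \<gamma>) * (v - a * m)"
    by (simp add: p_def q_def algebra_simps)
  with \<open>v > 0\<close> show ?thesis by (rule that)
qed

section \<open>The sharp bound on \<open>tau\<close>\<close>

text \<open>Zero at odd \<open>j\<close>, where the degree \<open>j + 3\<close> is even, so that the
  squares sum to a tail of the series of sinh and not of exp.\<close>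

definition tau_weight :: "real \<Rightarrow> real \<Rightarrow> nat \<Rightarrow> real" where
  "tau_weight \<beta> \<Lambda> j = (if even j then (\<Lambda> - 1) ^ (j + 3) / (sqrt (fact (j + 3)) * \<beta> ^ (j + 2)) else 0)"

lemma tau_weight_sums:
  assumes "\<beta> > 0"
  shows "(\<lambda>j. (tau_weight \<beta> \<Lambda> j)\<^sup>2) sums (\<beta>\<^sup>2 * sinh ((\<Lambda> - 1)\<^sup>2 / \<beta>\<^sup>2) - (\<Lambda> - 1)\<^sup>2)"
proof -
  define x where "x = (\<Lambda> - 1)\<^sup>2 / \<beta>\<^sup>2"
  define s where "s = (\<lambda>n. if even n then 0 else x ^ n /\<^sub>R fact n)"
  have "s sums sinh x" unfolding s_def by (rule sinh_converges)
  then have "(\<lambda>j. s (j + 3)) sums (sinh x - (\<Sum>j<3. s j))"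
    by (simp add: sums_iff_shift)
  moreover have "(\<Sum>j<3. s j) = x"
    by (simp add: s_def eval_nat_numeral)
  ultimately have "(\<lambda>j. \<beta>\<^sup>2 * s (j + 3)) sums (\<beta>\<^sup>2 * (sinh x - x))"
    by (intro sums_mult) simp
  moreover have "\<beta>\<^sup>2 * s (j + 3) = (tau_weight \<beta> \<Lambda> j)\<^sup>2" for j
  proof -
    have "(\<beta> ^ (j + 3))\<^sup>2 = \<beta>\<^sup>2 * (\<beta> ^ (j + 2))\<^sup>2"
      by (simp add: power2_eq_square algebra_simps eval_nat_numeral)
    moreover have "x ^ (j + 3) = ((\<Lambda> - 1) ^ (j + 3))\<^sup>2 / (\<beta> ^ (j + 3))\<^sup>2"
      by (simp only: x_def power_divide) (simp only: mult.commute flip: power_mult)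
    ultimately have "\<beta>\<^sup>2 * x ^ (j + 3) = ((\<Lambda> - 1) ^ (j + 3))\<^sup>2 / (\<beta> ^ (j + 2))\<^sup>2"
      using assms by simp
    moreover have "\<beta>\<^sup>2 * (x ^ (j + 3) /\<^sub>R fact (j + 3)) = \<beta>\<^sup>2 * x ^ (j + 3) / fact (j + 3)"
      by (simp add: divide_inverse mult_ac)
    ultimately show ?thesis
      by (simp add: s_def tau_weight_def power_divide power_mult_distrib del: fact_Suc power_Suc)
  qed
  moreover have "\<beta>\<^sup>2 * (sinh x - x) = \<beta>\<^sup>2 * sinh x - (\<Lambda> - 1)\<^sup>2"
    using assms by (simp add: x_def algebra_simps)
  ultimately show ?thesis by (simp add: x_def)
qed

text \<open>Cauchy-Schwarz on partial sums, then the limit. Bessel over the degrees 1 and 3 to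
  \<open>n + 2\<close> bounds the coefficients, with degree 1 moved to the right.\<close>

lemma tau_square_le:
  assumes f: "f \<in> L2_odd" and "\<beta> > 0"
  shows "(tau f \<beta> \<Lambda>)\<^sup>2 \<le> ((gauss_norm f)\<^sup>2 - (hermite_coeff f 1)\<^sup>2) *
    (\<beta>\<^sup>2 * sinh ((\<Lambda> - 1)\<^sup>2 / \<beta>\<^sup>2) - (\<Lambda> - 1)\<^sup>2)" (is "_ \<le> ?B * ?T")
proof -
  define c where "c = (\<lambda>j. hermite_coeff f (j + 3))"
  define W where "W = tau_weight \<beta> \<Lambda>"
  have W: "(\<lambda>j. (W j)\<^sup>2) sums ?T"
    unfolding W_def using \<open>\<beta> > 0\<close> by (rule tau_weight_sums)
  have W_le: "(\<Sum>j<n. (W j)\<^sup>2) \<le> ?T" for n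
    using sum_le_suminf[OF sums_summable[OF W], of "{..<n}"] sums_unique[OF W] by simp
  have "hermite_coeff f (j + 3) = 0" if "odd j" for j
    using f that by (intro hermite_coeff_odd_even) (auto simp: L2_odd_def)
  then have tau: "tau f \<beta> \<Lambda> = (\<Sum>j. c j * W j)"
    unfolding tau_def c_def W_def tau_weight_def
    by (intro suminf_cong) (auto simp del: fact_Suc power_Suc)
  have c_le: "(\<Sum>j<n. (c j)\<^sup>2) \<le> ?B" for n
  proof -
    have "(\<Sum>k\<in>insert 1 ((\<lambda>j. j + 3) ` {..<n}). (hermite_coeff f k)\<^sup>2) \<le> (gauss_norm f)\<^sup>2"
      using f L2_odd_subset by (intro bessel_hermite) auto
    also have "(\<Sum>k\<in>insert 1 ((\<lambda>j. j + 3) ` {..<n}). (hermite_coeff f k)\<^sup>2) =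
        (hermite_coeff f 1)\<^sup>2 + (\<Sum>j<n. (c j)\<^sup>2)"
      by (subst sum.insert) (auto simp: sum.reindex c_def)
    finally show ?thesis by simp
  qed
  \<comment> \<open>Summability is needed for \<open>tau\<close>, a \<open>suminf\<close>, to be the
    limit of its partial sums.\<close>
  have "summable (\<lambda>j. (c j)\<^sup>2)"
    using c_le by (intro summableI_nonneg_bounded) auto
  then have "summable (\<lambda>j. (c j)\<^sup>2 + (W j)\<^sup>2)"
    using sums_summable[OF W] by (intro summable_add)
  moreover have "norm (c j * W j) \<le> (c j)\<^sup>2 + (W j)\<^sup>2" for j
    using sum_squares_bound[of "\<bar>c j\<bar>" "\<bar>W j\<bar>"] abs_ge_zero[of "c j * W j"]
    unfolding real_norm_def abs_mult power2_abs by linarith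
  ultimately have "summable (\<lambda>j. c j * W j)"
    by (rule summable_comparison_test'[where N = 0])
  then have "(\<lambda>n. (\<Sum>j<n. c j * W j)\<^sup>2) \<longlonglongrightarrow> (tau f \<beta> \<Lambda>)\<^sup>2"
    unfolding tau by (intro tendsto_power summable_LIMSEQ)
  moreover have "(\<Sum>j<n. c j * W j)\<^sup>2 \<le> ?B * ?T" for n
    using c_le[of 0]
    by (intro order_trans[OF Cauchy_Schwarz_ineq_sum] mult_mono c_le W_le sum_nonneg) auto
  ultimately show ?thesis
    by (blast intro: LIMSEQ_le_const2)
qed

section \<open>Necessity and sufficiency of the sinh criterion\<close>

lemma recovery_region_necessary:
  assumes "\<gamma> > 0" "\<beta> > 0" and f: "f \<in> L2_odd" and \<Lambda>: "\<Lambda> \<in> recovery_region f \<gamma> \<beta>"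
  shows "\<gamma> < \<beta>\<^sup>2 * sinh ((\<Lambda> - 1)\<^sup>2 / \<beta>\<^sup>2)"
proof (rule ccontr)
  define m where "m = \<Lambda> - 1"
  define T where "T = \<beta>\<^sup>2 * sinh (m\<^sup>2 / \<beta>\<^sup>2) - m\<^sup>2"
  define a where "a = hermite_coeff f 1"
  define b where "b = (gauss_norm f)\<^sup>2 - a\<^sup>2"
  define t where "t = tau f \<beta> \<Lambda>"
  assume "\<not> ?thesis"
  then have T_le: "T \<le> \<gamma> - m\<^sup>2" by (simp add: T_def m_def)
  have m: "m > 0" using \<Lambda> by (simp add: recovery_region_def m_def)
  have "m\<^sup>2 / \<beta>\<^sup>2 < sinh (m\<^sup>2 / \<beta>\<^sup>2)"
    using m assms by (intro less_sinh) simp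
  then have T: "T > 0"
    using assms by (simp add: T_def field_simps)
  have t: "t\<^sup>2 \<le> b * T"
    using tau_square_le[OF f \<open>\<beta> > 0\<close>, of \<Lambda>] by (simp add: t_def b_def T_def a_def m_def)
  then have b: "b \<ge> 0"
    using T by (meson order_trans zero_le_mult_iff zero_le_power2 not_less)
  consider "a > 0" "psi' f \<gamma> (s_plus f \<gamma> \<beta> \<Lambda>) > 0" | "a = 0" "t > sqrt \<gamma> * gauss_norm f"
    using \<Lambda> by (auto simp: recovery_region_def a_def t_def)
  then show False
  proof cases
    case 1
    obtain v where v: "v > 0" "t * v = (v + a * \<gamma>) * (v - a * m)"
      using ex_pos_root[of a m \<gamma> t] 1 m assms by blast
    have "s_plus f \<gamma> \<beta> \<Lambda> = - 1 / (v + a * \<gamma>)"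
      using 1 m v assms by (intro s_plus_eq) (auto simp: a_def m_def t_def)
    then have "psi' f \<gamma> (s_plus f \<gamma> \<beta> \<Lambda>) =
        (v + a * \<gamma>)\<^sup>2 * (v\<^sup>2 - a\<^sup>2 * \<gamma>) / v\<^sup>2 - \<gamma> * b"
      using psi'_eq[of f a \<gamma> v] 1 v assms by (simp only: a_def b_def)
    with 1 have psi: "0 < (v + a * \<gamma>)\<^sup>2 * (v\<^sup>2 - a\<^sup>2 * \<gamma>) / v\<^sup>2 - \<gamma> * b"
      by simp
    define P where "P = (v + a * \<gamma>)\<^sup>2"
    define D where "D = v\<^sup>2 - a\<^sup>2 * \<gamma>"
    have P: "P > 0" 
      using v 1 assms unfolding P_def by (intro zero_less_power add_pos_pos) auto
    have bD: "\<gamma> * b * v\<^sup>2 < P * D"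
      using psi v by (simp add: P_def D_def field_simps)
    moreover have "0 \<le> \<gamma> * b * v\<^sup>2" using b assms by simp
    ultimately have "0 < P * D" by linarith
    then have D: "D > 0" using P by (simp add: zero_less_mult_iff)
    \<comment> \<open>Eliminates \<open>t\<close> by \<open>t\<^sup>2 \<le> b * T\<close> and then
      \<open>b\<close> by \<open>bD\<close>; the positive factor \<open>P\<close> cancels at the
      end.\<close>
    have "P * (\<gamma> * (v - a * m)\<^sup>2) = \<gamma> * (t * v)\<^sup>2"
      unfolding v P_def by (simp add: power_mult_distrib)
    also have "\<dots> \<le> \<gamma> * (b * T * v\<^sup>2)"
      using mult_right_mono[OF t zero_le_power2[of v]] assms by (simp add: power_mult_distrib)
    also have "\<dots> = (\<gamma> * b * v\<^sup>2) * T" by simp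
    also have "\<dots> < P * D * T" using bD T by simp
    also have "\<dots> \<le> P * (D * (\<gamma> - m\<^sup>2))" using P D T_le by simp
    finally have "\<gamma> * (v - a * m)\<^sup>2 < D * (\<gamma> - m\<^sup>2)" using P by simp
    \<comment> \<open>The gap is minus a square, vanishing exactly at
      \<open>v = a * \<gamma> / m\<close>, the value chosen for sufficiency.\<close>
    moreover have "D * (\<gamma> - m\<^sup>2) - \<gamma> * (v - a * m)\<^sup>2 = - (\<gamma> * a - m * v)\<^sup>2"
      by (simp add: D_def power2_eq_square algebra_simps)
    ultimately show False
      using zero_le_power2[of "\<gamma> * a - m * v"] by linarith
  next
    case 2
    have "gauss_norm f \<ge> 0"
      by (auto simp: gauss_norm_def gauss_inner_def intro!: Bochner_Integration.integral_nonneg)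
    then have "(sqrt \<gamma> * gauss_norm f)\<^sup>2 < t\<^sup>2"
      using 2 assms by (intro power_strict_mono) auto
    then have "\<gamma> * b < t\<^sup>2"
      using 2 assms by (simp add: power_mult_distrib b_def)
    also have "\<dots> \<le> b * (\<gamma> - m\<^sup>2)"
      using t T_le b by (meson mult_left_mono order_trans)
    also have "\<dots> \<le> \<gamma> * b"
      using b by (simp add: algebra_simps)
    finally show False by simp
  qed
qed

text \<open>Builds a polynomial \<open>f\<close> with \<open>a = 1\<close> for which the estimates
  of the necessity proof are equalities up to truncation at \<open>n\<close>; the strict hypothesis
  absorbs the truncation.\<close>

lemma recovery_region_sufficient:
  assumes "\<gamma> > 0" "\<beta> > 0" "\<Lambda> > 1" "(\<Lambda> - 1)\<^sup>2 < \<gamma>"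
    and "\<gamma> < \<beta>\<^sup>2 * sinh ((\<Lambda> - 1)\<^sup>2 / \<beta>\<^sup>2)"
  shows "\<Lambda> \<in> (\<Union>f\<in>L2_odd. recovery_region f \<gamma> \<beta>)"
proof -
  define m where "m = \<Lambda> - 1"
  have m: "m > 0" "m\<^sup>2 < \<gamma>" using assms by (auto simp: m_def)
  define W where "W = tau_weight \<beta> \<Lambda>"
  have "(\<lambda>n. \<Sum>j<n. (W j)\<^sup>2) \<longlonglongrightarrow> \<beta>\<^sup>2 * sinh (m\<^sup>2 / \<beta>\<^sup>2) - m\<^sup>2"
    using tau_weight_sums[OF \<open>\<beta> > 0\<close>] by (simp add: W_def m_def sums_def)
  moreover have "\<gamma> - m\<^sup>2 < \<beta>\<^sup>2 * sinh (m\<^sup>2 / \<beta>\<^sup>2) - m\<^sup>2"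
    using assms by (simp add: m_def)
  ultimately have "\<forall>\<^sub>F n in sequentially. \<gamma> - m\<^sup>2 < (\<Sum>j<n. (W j)\<^sup>2)"
    by (rule order_tendstoD)
  then obtain n where n: "\<gamma> - m\<^sup>2 < (\<Sum>j<n. (W j)\<^sup>2)"
    by (auto simp: eventually_sequentially)
  define S where "S = (\<Sum>j<n. (W j)\<^sup>2)"
  have S: "S > 0" "\<gamma> - m\<^sup>2 < S" using n m by (auto simp: S_def)
  \<comment> \<open>The value forced by \<open>t * v = (v + \<gamma>) * (v - m)\<close> at
    \<open>v = \<gamma> / m\<close>.\<close>
  define t where "t = (1 + m) * (\<gamma> - m\<^sup>2) / m"
  \<comment> \<open>Coefficients proportional to the weights give equality in Cauchy-Schwarz; the
    factor \<open>t / S\<close> makes \<open>tau\<close> equal to \<open>t\<close>.\<close>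
  define c where "c = (\<lambda>k. if k = 1 then 1 else if k \<ge> 3 then t / S * W (k - 3) else 0)"
  define f where "f = (\<lambda>z. \<Sum>k<n + 3. c k * hermite k z)"
  have c: "c k = 0" if "even k" for k
    using that by (auto simp: c_def W_def tau_weight_def)
  have f: "f \<in> L2_odd"
    and coeff: "hermite_coeff f k = (if k < n + 3 then c k else 0)"
    and norm: "(gauss_norm f)\<^sup>2 = (\<Sum>k<n + 3. (c k)\<^sup>2)" for k
    unfolding f_def using hermite_combination[of c, OF c] by blast+
  have a: "hermite_coeff f 1 = 1" by (simp add: coeff c_def)
  have c3: "c (j + 3) = t / S * W j" for j by (simp add: c_def)
  have "(\<Sum>k<n + 3. (c k)\<^sup>2) = (\<Sum>k<3. (c k)\<^sup>2) + (\<Sum>j<n. (c (j + 3))\<^sup>2)"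
    using sum.atLeastLessThan_concat[of 0 3 "n + 3" "\<lambda>k. (c k)\<^sup>2"]
      sum.shift_bounds_nat_ivl[of "\<lambda>k. (c k)\<^sup>2" 0 3 n]
    by (simp add: atLeast0LessThan)
  also have "(\<Sum>k<3. (c k)\<^sup>2) = 1"
    by (simp add: c_def eval_nat_numeral)
  also have "(\<Sum>j<n. (c (j + 3))\<^sup>2) = (t / S)\<^sup>2 * S"
    by (simp only: c3 power_mult_distrib flip: sum_distrib_left S_def)
  finally have b: "(gauss_norm f)\<^sup>2 - 1\<^sup>2 = t\<^sup>2 / S"
    using norm S by (simp add: power2_eq_square)
  have "tau f \<beta> \<Lambda> = (\<Sum>j. if j < n then t / S * (W j)\<^sup>2 else 0)"
    unfolding tau_def coeff c3 W_def tau_weight_def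
    by (intro suminf_cong) (auto simp: power2_eq_square mult_ac simp del: fact_Suc power_Suc)
  also have "\<dots> = (\<Sum>j<n. t / S * (W j)\<^sup>2)"
    by (subst suminf_finite[of "{..<n}"]) auto
  also have "\<dots> = t / S * S"
    by (simp only: flip: sum_distrib_left S_def)
  also have "\<dots> = t"
    using S by simp
  finally have tau: "tau f \<beta> \<Lambda> = t" .
  define v where "v = \<gamma> / m"
  have v: "v > 0" using m assms by (simp add: v_def)
  have tv: "t * v = (v + 1 * \<gamma>) * (v - 1 * (\<Lambda> - 1))"
    using m by (simp add: t_def v_def field_simps power2_eq_square flip: m_def)
  have "s_plus f \<gamma> \<beta> \<Lambda> = - 1 / (v + 1 * \<gamma>)"
    using a tv v assms by (intro s_plus_eq) (auto simp: tau)
  then have psi: "psi' f \<gamma> (s_plus f \<gamma> \<beta> \<Lambda>) =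
      (v + 1 * \<gamma>)\<^sup>2 * (v\<^sup>2 - 1\<^sup>2 * \<gamma>) / v\<^sup>2 - \<gamma> * (t\<^sup>2 / S)"
    using psi'_eq[OF a zero_less_one \<open>\<gamma> > 0\<close> v] by (simp only: b)
  define Q where "Q = (v + \<gamma>)\<^sup>2 / v\<^sup>2"
  have Q: "Q > 0" 
    using v assms unfolding Q_def by (intro divide_pos_pos zero_less_power add_pos_pos) auto
  have "t = (v + \<gamma>) * (v - m) / v"
    using tv v by (simp add: field_simps m_def)
  then have "t\<^sup>2 = Q * (v - m)\<^sup>2"
    by (simp add: Q_def power_divide power_mult_distrib)
  also have "v - m = (\<gamma> - m\<^sup>2) / m"
    using m by (simp add: v_def field_simps power2_eq_square)
  finally have t2: "t\<^sup>2 = Q * (\<gamma> - m\<^sup>2)\<^sup>2 / m\<^sup>2" by (simp add: power_divide)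
  \<comment> \<open>Used with \<open>D = \<gamma> - m\<^sup>2\<close> and
    \<open>M = m\<^sup>2\<close>; positivity then comes down to \<open>D < S\<close>, which is how
    \<open>n\<close> was chosen.\<close>
  have factor: "Q * \<gamma> * D / M - \<gamma> * (Q * D\<^sup>2 / M / S) = Q * \<gamma> * D / M * (1 - D / S)" for D M
    by (simp add: power2_eq_square algebra_simps diff_divide_distrib)
  have "v\<^sup>2 - \<gamma> = \<gamma> * (\<gamma> - m\<^sup>2) / m\<^sup>2"
    using m by (simp add: v_def field_simps power2_eq_square)
  then have "(v + 1 * \<gamma>)\<^sup>2 * (v\<^sup>2 - 1\<^sup>2 * \<gamma>) / v\<^sup>2 - \<gamma> * (t\<^sup>2 / S)
      = Q * \<gamma> * (\<gamma> - m\<^sup>2) / m\<^sup>2 - \<gamma> * (Q * (\<gamma> - m\<^sup>2)\<^sup>2 / m\<^sup>2 / S)"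
    by (simp add: t2 Q_def mult_ac)
  also have "\<dots> = Q * \<gamma> * (\<gamma> - m\<^sup>2) / m\<^sup>2 * (1 - (\<gamma> - m\<^sup>2) / S)"
    using factor .
  also have "\<dots> > 0"
    using Q S m assms by (intro mult_pos_pos divide_pos_pos) auto
  finally have "\<Lambda> \<in> recovery_region f \<gamma> \<beta>"
    using psi a assms by (simp add: recovery_region_def)
  with f show ?thesis by blast
qed

section \<open>The critical value in closed form\<close>

lemma lambda_star_eq:
  assumes "\<gamma> > 0" "\<beta> > 0"
  shows "lambda_star \<gamma> \<beta> = 1 + region_edge \<gamma> \<beta>"
proof (rule antisym)
  show "1 + region_edge \<gamma> \<beta> \<le> lambda_star \<gamma> \<beta>"
    unfolding lambda_star_def
  proof (rule cInf_greatest[OF recovery_region_Union_nonempty[OF \<open>\<gamma> > 0\<close>]])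
    fix \<Lambda> assume "\<Lambda> \<in> (\<Union>f\<in>L2_odd. recovery_region f \<gamma> \<beta>)"
    then obtain f where f: "f \<in> L2_odd" "\<Lambda> \<in> recovery_region f \<gamma> \<beta>" by blast
    then have "\<Lambda> > 1" by (simp add: recovery_region_def)
    then show "1 + region_edge \<gamma> \<beta> \<le> \<Lambda>"
      using recovery_region_necessary[OF assms f] less_sinh_iff_region_edge_less[OF assms, of "\<Lambda> - 1"]
      by simp
  qed
  have "1 + region_edge \<gamma> \<beta> < 1 + sqrt \<gamma>"
    using region_edge_less_sqrt[OF assms] by simp
  then show "lambda_star \<gamma> \<beta> \<le> 1 + region_edge \<gamma> \<beta>"
  \<comment> \<open>Only values below \<open>1 + sqrt \<gamma>\<close> need testing, which is where
    the sufficiency lemma applies.\<close>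
  proof (rule dense_ge_bounded)
    fix \<Lambda> assume \<Lambda>: "1 + region_edge \<gamma> \<beta> < \<Lambda>" "\<Lambda> < 1 + sqrt \<gamma>"
    then have pos: "\<Lambda> > 1" using region_edge_pos[OF assms] by simp
    then have "(\<Lambda> - 1)\<^sup>2 < (sqrt \<gamma>)\<^sup>2"
      using \<Lambda> by (intro power_strict_mono) auto
    then have "\<Lambda> \<in> (\<Union>f\<in>L2_odd. recovery_region f \<gamma> \<beta>)"
      using \<Lambda> pos assms less_sinh_iff_region_edge_less[OF assms, of "\<Lambda> - 1"]
      by (intro recovery_region_sufficient) auto
    then show "lambda_star \<gamma> \<beta> \<le> \<Lambda>"
      unfolding lambda_star_def by (intro cInf_lower recovery_region_bdd_below)
  qed
qed

theorem corollary2p10: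
  fixes \<gamma> :: real
  assumes "\<gamma> > 0"
  shows "strict_mono_on {0<..} (\<lambda>\<beta>. lambda_star \<gamma> \<beta>) \<and>
    ((\<lambda>\<beta>. lambda_star \<gamma> \<beta>) \<longlongrightarrow> 1 + sqrt \<gamma>) at_top"
proof
  show "strict_mono_on {0<..} (\<lambda>\<beta>. lambda_star \<gamma> \<beta>)"
    using strict_mono_region_edge[OF assms] assms
    by (auto simp: strict_mono_on_def lambda_star_eq)
  have "((\<lambda>\<beta>. 1 + region_edge \<gamma> \<beta>) \<longlongrightarrow> 1 + sqrt \<gamma>) at_top"
    by (intro tendsto_intros region_edge_tendsto assms)
  moreover have "\<forall>\<^sub>F \<beta> in at_top. 1 + region_edge \<gamma> \<beta> = lambda_star \<gamma> \<beta>"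
    using eventually_gt_at_top[of 0] by eventually_elim (simp add: lambda_star_eq assms)
  ultimately show "((\<lambda>\<beta>. lambda_star \<gamma> \<beta>) \<longlongrightarrow> 1 + sqrt \<gamma>) at_top"
    by (rule Lim_transform_eventually)
qed

end
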